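(* Let $k\ge1$ and let $H^{(1)}$ and $H^{(2)}$ be labelled multihypergraphs having layer-contained certificates for the same integer $k$. Suppose that their vertex sets meet in exactly one vertex $r$ and that their hyperedge-occurrence sets are disjoint. Then the one-vertex sum $H^{(1)}\vee_r H^{(2)}$ has a layer-contained certificate (for $k$). In particular, $H^{(1)}\vee_r H^{(2)}$ is $k$-critical, $k$-weakly-partition-connected, and has a $k$-distinguishable tree assignment.
   Context: A labelled multihypergraph $H=(V,E)$ has a finite vertex set $V$ with $|V|\ge 2$ and a finite set $E=E(H)$ of hyperedge occurrences, each with a support that is a subset of $V$ of cardinality at least $2$ (standing assumptions); distinct occurrences may have the same support and remain distinct. We write $e$ both for the occurrence and its support. For a partition $\mathcal P$ of $V$ let $p_{\mathcal P}(e)$ be the number of blocks of $\mathcal P$ met by $e$, and $w_H(\mathcal P)=\sum_{e\in E}(p_{\mathcal P}(e)-1)$. $H$ is $k$-weakly-partition-connected if $w_H(\mathcal P)\ge k(|\mathcal P|-1)$ for every partition $\mathcal P$ of $V$. With $\rho(H)=\sum_{e\in E}(|e|-1)$, $H$ is $k$-critical if $\rho(H)=k(|V|-1)$. A tree assignment of $H$ chooses, for every $e\in E$, a simple tree $F_e$ with vertex set $e$ and labels every edge of $F_e$ by $e$; the assigned graph is the labelled multigraph $G=\biguplus_{e\in E}F_e$ on $V$ (disjoint union of labelled edge occurrences; parallel edges may arise only from distinct labels). An ordered $k$-tree decomposition of a labelled graph $G$ on $V$ is an ordered partition $E(G)=E(T_0)\,\dot\cup\,\cdots\,\dot\cup\,E(T_{k-1})$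 of all edge occurrences in which every $T_i$ is a spanning tree of $V$ (containing no parallel pair). Its signature is the vector indexed by $e\in E$ with $\mathrm{sig}_{\mathcal T}(e)=\sum_{i=0}^{k-1} i\,|E(T_i)\cap E(F_e)|$. The assignment $G$ is $k$-distinguishable if it has an ordered $k$-tree decomposition $\mathcal T$ such that every ordered $k$-tree decomposition $\mathcal T'$ of $G$ with $\mathrm{sig}_{\mathcal T'}=\mathrm{sig}_{\mathcal T}$ equals $\mathcal T$. A layer-contained certificate for $H$ (for the integer $k$) consists of a tree assignment $G=\biguplus_{e\in E(H)}F_e$, an ordered $k$-tree decomposition $\mathcal T=(T_0,\ldots,T_{k-1})$ of $G$, and a map $\ell:E(H)\to\{0,\ldots,k-1\}$ such that $E(F_e)\subseteq E(T_{\ell(e)})$ for every hyperedge occurrence $e$. If $H^{(1)},H^{(2)}$ have vertex sets $V_1,V_2$ with $V_1\cap V_2=\{r\}$ and disjoint hyperedge-occurrence sets, their one-vertex sum $H^{(1)}\vee_r H^{(2)}$ has vertex set $V_1\cup V_2$ and as hyperedge occurrences the disjoint union of those of $H^{(1)}$ and $H^{(2)}$. *)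

theory Defs
  imports Main "HOL-Library.Disjoint_Sets"
begin

record ('v, 'e) mhg =
  hverts :: "'v set"
  hedges :: "'e set"
  support :: "'e \<Rightarrow> 'v set"

definition multihypergraph :: "('v, 'e) mhg \<Rightarrow> bool" where
  "multihypergraph H \<longleftrightarrow>
     finite (hverts H) \<and> 2 \<le> card (hverts H) \<and> finite (hedges H) \<and>
     (\<forall>e\<in>hedges H. support H e \<subseteq> hverts H \<and> 2 \<le> card (support H e))"


subsection \<open>Partition connectivity and criticality\<close>

definition blocks_met :: "('v, 'e) mhg \<Rightarrow> 'v set set \<Rightarrow> 'e \<Rightarrow> nat" where
  "blocks_met H P e = card {B \<in> P. B \<inter> support H e \<noteq> {}}"

definition partition_weight :: "('v, 'e) mhg \<Rightarrow> 'v set set \<Rightarrow> int" where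
  "partition_weight H P = (\<Sum>e\<in>hedges H. int (blocks_met H P e) - 1)"

definition weakly_partition_connected :: "nat \<Rightarrow> ('v, 'e) mhg \<Rightarrow> bool" where
  "weakly_partition_connected k H \<longleftrightarrow>
     (\<forall>P. partition_on (hverts H) P \<longrightarrow> partition_weight H P \<ge> int k * (int (card P) - 1))"

definition hyper_rho :: "('v, 'e) mhg \<Rightarrow> int" where
  "hyper_rho H = (\<Sum>e\<in>hedges H. int (card (support H e)) - 1)"

definition critical :: "nat \<Rightarrow> ('v, 'e) mhg \<Rightarrow> bool" where
  "critical k H \<longleftrightarrow> hyper_rho H = int k * (int (card (hverts H)) - 1)"


subsection \<open>Simple trees and spanning trees of labelled multigraphs\<close>

text \<open>An edge of a simple graph is the two-element set of its end vertices.\<close>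

definition simple_edges_on :: "'v set \<Rightarrow> 'v set set \<Rightarrow> bool" where
  "simple_edges_on V F \<longleftrightarrow> (\<forall>f\<in>F. f \<subseteq> V \<and> card f = 2)"

definition graph_connected :: "'v set \<Rightarrow> 'v set set \<Rightarrow> bool" where
  "graph_connected V F \<longleftrightarrow>
     V \<noteq> {} \<and> (\<forall>u\<in>V. \<forall>v\<in>V. (u, v) \<in> {(x, y). {x, y} \<in> F}\<^sup>*)"

definition graph_cycle :: "'v set set \<Rightarrow> 'v list \<Rightarrow> bool" where
  "graph_cycle F c \<longleftrightarrow>
     3 \<le> length c \<and> distinct c \<and>
     (\<forall>i<length c. {c ! i, c ! (Suc i mod length c)} \<in> F)"

definition simple_tree :: "'v set \<Rightarrow> 'v set set \<Rightarrow> bool" where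
  "simple_tree V F \<longleftrightarrow>
     simple_edges_on V F \<and> graph_connected V F \<and> (\<nexists>c. graph_cycle F c)"

text \<open>An edge occurrence of a labelled multigraph is a pair of a label and a two-element set of
  end vertices, so that parallel edges are pairs with the same second component.\<close>

definition spanning_tree :: "'v set \<Rightarrow> ('e \<times> 'v set) set \<Rightarrow> bool" where
  "spanning_tree V T \<longleftrightarrow> inj_on snd T \<and> simple_tree V (snd ` T)"


subsection \<open>Tree assignments and ordered tree decompositions\<close>

definition tree_assignment :: "('v, 'e) mhg \<Rightarrow> ('e \<Rightarrow> 'v set set) \<Rightarrow> bool" where
  "tree_assignment H F \<longleftrightarrow> (\<forall>e\<in>hedges H. simple_tree (support H e) (F e))"

definition labelled_edges :: "('e \<Rightarrow> 'v set set) \<Rightarrow> 'e \<Rightarrow> ('e \<times> 'v set) set" where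
  "labelled_edges F e = {e} \<times> F e"

definition assigned_edges :: "('v, 'e) mhg \<Rightarrow> ('e \<Rightarrow> 'v set set) \<Rightarrow> ('e \<times> 'v set) set" where
  "assigned_edges H F = (\<Union>e\<in>hedges H. labelled_edges F e)"

text \<open>Only the values \<open>T i\<close> with \<open>i < k\<close> of the map \<open>T\<close> are part of the decomposition.\<close>

definition ordered_tree_decomposition ::
    "nat \<Rightarrow> 'v set \<Rightarrow> ('e \<times> 'v set) set \<Rightarrow> (nat \<Rightarrow> ('e \<times> 'v set) set) \<Rightarrow> bool" where
  "ordered_tree_decomposition k V E T \<longleftrightarrow>
     (\<Union>i<k. T i) = E \<and> disjoint_family_on T {..<k} \<and> (\<forall>i<k. spanning_tree V (T i))"

definition tree_signature ::
    "nat \<Rightarrow> ('e \<Rightarrow> 'v set set) \<Rightarrow> (nat \<Rightarrow> ('e \<times> 'v set) set) \<Rightarrow> 'e \<Rightarrow> nat" where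
  "tree_signature k F T e = (\<Sum>i<k. i * card (T i \<inter> labelled_edges F e))"

definition distinguishable :: "nat \<Rightarrow> ('v, 'e) mhg \<Rightarrow> ('e \<Rightarrow> 'v set set) \<Rightarrow> bool" where
  "distinguishable k H F \<longleftrightarrow>
     (\<exists>T. ordered_tree_decomposition k (hverts H) (assigned_edges H F) T \<and>
        (\<forall>T'. ordered_tree_decomposition k (hverts H) (assigned_edges H F) T' \<and>
              (\<forall>e\<in>hedges H. tree_signature k F T' e = tree_signature k F T e)
           \<longrightarrow> (\<forall>i<k. T' i = T i)))"

definition layer_contained_certificate ::
    "nat \<Rightarrow> ('v, 'e) mhg \<Rightarrow> ('e \<Rightarrow> 'v set set) \<Rightarrow> (nat \<Rightarrow> ('e \<times> 'v set) set) \<Rightarrow> ('e \<Rightarrow> nat) \<Rightarrow> bool"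
  where
  "layer_contained_certificate k H F T l \<longleftrightarrow>
     tree_assignment H F \<and>
     ordered_tree_decomposition k (hverts H) (assigned_edges H F) T \<and>
     (\<forall>e\<in>hedges H. l e < k \<and> labelled_edges F e \<subseteq> T (l e))"


subsection \<open>One-vertex sums\<close>

text \<open>Intended for hypergraphs whose vertex sets meet in exactly one vertex and whose occurrence
  sets are disjoint; these conditions are hypotheses wherever the sum is used.\<close>

definition one_vertex_sum :: "('v, 'e) mhg \<Rightarrow> ('v, 'e) mhg \<Rightarrow> ('v, 'e) mhg" where
  "one_vertex_sum H1 H2 =
     \<lparr> hverts = hverts H1 \<union> hverts H2,
       hedges = hedges H1 \<union> hedges H2,
       support = (\<lambda>e. if e \<in> hedges H1 then support H1 e else support H2 e) \<rparr>"

lemma multihypergraph_one_vertex_sum: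
  assumes "multihypergraph H1" "multihypergraph H2"
  shows "multihypergraph (one_vertex_sum H1 H2)"
proof -
  have "card (hverts H1) \<le> card (hverts H1 \<union> hverts H2)"
    using assms by (intro card_mono) (auto simp: multihypergraph_def)
  then show ?thesis
    using assms by (auto simp: multihypergraph_def one_vertex_sum_def)
qed

end

theory Submission
  imports Defs
begin

text \<open>
  In a layer-contained certificate the spanning tree \<open>T i\<close> consists of exactly the edges of the
  hyperedges with label \<open>i\<close>. Taking unions of the given certificates layer by layer yields one for
  the sum, and the remaining claims hold for every hypergraph that has such a certificate.

  That two trees sharing one vertex form a tree is proved by counting rather than by following a
  cycle through the shared vertex: a connected graph on a finite vertex set is a tree iff it has one
  edge less than vertices (\<open>simple_tree_iff_card\<close>), and the union inherits both connectedness and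
  this count (\<open>simple_tree_Un\<close>). The equivalence rests on the bound
  \<open>card X \<le> 1 + (\<Sum>e\<in>A. card (M e) - 1)\<close> for connected hypergraphs
  (\<open>connected_hypergraph_card_le\<close>) and on the existence of leaves in forests (\<open>acyclic_leaf\<close>).

  Criticality comes from counting the edges of the assigned graph once by hyperedges and once by
  layers. For a partition \<open>P\<close> of the vertex set, the hyperedges of one layer form a connected
  hypergraph on the set of blocks, so the same bound gives weight at least \<open>card P - 1\<close> for each of
  the \<open>k\<close> layers. Finally, the signature determines the layers one after the other: once the layers
  below \<open>i\<close> are known, the edges of a hyperedge of label \<open>i\<close> can only lie in layers \<open>\<ge> i\<close>, and
  its signature, \<open>i\<close> times the number of these edges, is attained only if all of them lie in layer
  \<open>i\<close>. Spanning trees have equally many edges, so layer \<open>i\<close> contains nothing else.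
\<close>

section \<open>Counting edges of connected hypergraphs and of trees\<close>

text \<open>Grow a vertex set \<open>S\<close> from a single vertex, each time absorbing a hyperedge that crosses the
  boundary of \<open>S\<close>. Such a hyperedge adds at most \<open>card (M e) - 1\<close> vertices, and is not among those
  contained in \<open>S\<close> before. The proof takes a largest \<open>S\<close> that satisfies the bound.\<close>

lemma connected_hypergraph_card_le:
  assumes "finite X" "finite A" "\<And>e. e \<in> A \<Longrightarrow> M e \<subseteq> X"
    and cut: "\<And>S. S \<noteq> {} \<Longrightarrow> S \<subset> X \<Longrightarrow> \<exists>e\<in>A. M e \<inter> S \<noteq> {} \<and> \<not> M e \<subseteq> S"
  shows "card X \<le> 1 + (\<Sum>e\<in>A. card (M e) - 1)"
proof (cases "X = {}")
  case False
  then obtain x where x: "x \<in> X" by blast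
  define inner where "inner S = {e \<in> A. M e \<subseteq> S}" for S
  define good where "good S \<longleftrightarrow> S \<subseteq> X \<and> S \<noteq> {} \<and> card S \<le> 1 + (\<Sum>e\<in>inner S. card (M e) - 1)" for S
  have "good {x}" using x by (simp add: good_def)
  moreover have "finite {S. good S}"
    by (rule finite_subset[of _ "Pow X"]) (use assms(1) in \<open>auto simp: good_def\<close>)
  ultimately obtain S where S: "good S" and max: "\<And>S'. good S' \<Longrightarrow> S \<subseteq> S' \<Longrightarrow> S' = S"
    using finite_has_maximal2[of "{S. good S}" "{x}"] by auto
  have fin: "finite (inner S')" for S' using assms(2) by (simp add: inner_def)
  have "S = X"
  proof (rule ccontr)
    assume "S \<noteq> X"
    then obtain e where e: "e \<in> A" "M e \<inter> S \<noteq> {}" "\<not> M e \<subseteq> S"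
      using cut[of S] S unfolding good_def by blast
    have fM: "finite (M e)" "finite S"
      using finite_subset[OF _ assms(1)] assms(3) e(1) S by (auto simp: good_def)
    then have "card (M e \<inter> S) \<ge> 1" using e(2) by (simp add: Suc_le_eq card_gt_0_iff)
    then have "card (S \<union> M e) \<le> card S + (card (M e) - 1)"
      using card_Un_Int[OF fM(2,1)] by (simp add: Int_commute)
    also have "\<dots> \<le> 1 + (\<Sum>f\<in>insert e (inner S). card (M f) - 1)"
      using S e(3) fin by (simp add: good_def inner_def)
    also have "(\<Sum>f\<in>insert e (inner S). card (M f) - 1) \<le> (\<Sum>f\<in>inner (S \<union> M e). card (M f) - 1)"
      using fin e(1) by (intro sum_mono2) (auto simp: inner_def)
    finally have "good (S \<union> M e)"
      using S assms(3) e(1) by (auto simp: good_def)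
    then show False using max e(3) by blast
  qed
  then have "card X \<le> 1 + (\<Sum>e\<in>inner X. card (M e) - 1)" using S by (simp add: good_def)
  also have "inner X = A" using assms(3) by (auto simp: inner_def)
  finally show ?thesis .
qed simp

lemma graph_connected_crossing_edge:
  assumes "graph_connected V F" "u \<in> V" "v \<in> V" "u \<in> S" "v \<notin> S"
  shows "\<exists>x y. {x, y} \<in> F \<and> x \<in> S \<and> y \<notin> S"
proof (rule ccontr)
  assume *: "\<not> ?thesis"
  have "(u, v) \<in> {(x, y). {x, y} \<in> F}\<^sup>*" using assms by (simp add: graph_connected_def)
  then have "v \<in> S" by (induction rule: rtrancl_induct) (use assms(4) * in auto)
  then show False using assms(5) by simp
qed

lemma finite_simple_edges:
  assumes "finite V" "simple_edges_on V F"
  shows "finite F"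
proof (rule finite_subset)
  show "F \<subseteq> Pow V" using assms(2) by (auto simp: simple_edges_on_def)
qed (use assms(1) in simp)

lemma connected_card_le:
  assumes "finite V" "simple_edges_on V F"
    and cut: "\<And>S. S \<noteq> {} \<Longrightarrow> S \<subset> V \<Longrightarrow> \<exists>x y. {x, y} \<in> F \<and> x \<in> S \<and> y \<notin> S"
  shows "card V \<le> 1 + card F"
proof -
  have "card V \<le> 1 + (\<Sum>f\<in>F. card f - 1)"
  proof (rule connected_hypergraph_card_le[where M = "\<lambda>f. f"])
    show "finite F" using finite_simple_edges[OF assms(1,2)] .
    show "f \<subseteq> V" if "f \<in> F" for f using assms(2) that by (simp add: simple_edges_on_def)
    fix S assume "S \<noteq> {}" "S \<subset> V"
    with cut obtain x y where "{x, y} \<in> F" "x \<in> S" "y \<notin> S" by blast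
    then show "\<exists>f\<in>F. f \<inter> S \<noteq> {} \<and> \<not> f \<subseteq> S" by (intro bexI[of _ "{x, y}"]) auto
  qed (use assms in auto)
  also have "(\<Sum>f\<in>F. card f - 1) = card F"
    using assms(2) by (simp add: simple_edges_on_def)
  finally show ?thesis .
qed

text \<open>An end vertex of a longest path is a leaf: a second neighbour would lie on the path, by
  maximality, and would close a cycle.\<close>

lemma acyclic_leaf:
  assumes "finite V" "simple_edges_on V F" "F \<noteq> {}" and acyclic: "\<nexists>c. graph_cycle F c"
  obtains v f where "v \<in> V" "f \<in> F" "v \<in> f" "\<And>g. g \<in> F \<Longrightarrow> v \<in> g \<Longrightarrow> g = f"
proof -
  define path where "path xs \<longleftrightarrow> distinct xs \<and> set xs \<subseteq> V \<and>
      (\<forall>i. Suc i < length xs \<longrightarrow> {xs ! i, xs ! Suc i} \<in> F)" for xs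
  obtain f where f: "f \<in> F" "f \<subseteq> V" "card f = 2"
    using assms(2,3) by (auto simp: simple_edges_on_def)
  obtain u w where "f = {u, w}" "u \<noteq> w" using f(3) by (auto simp: card_2_iff)
  with f have uw: "{u, w} \<in> F" "u \<noteq> w" "u \<in> V" "w \<in> V" by simp_all
  then have start: "path [u, w]" by (auto simp: path_def)
  have bound: "length xs \<le> card V" if "path xs" for xs
    using that assms(1) card_mono[of V "set xs"] by (auto simp: path_def distinct_card)
  define xs where "xs = arg_max length path"
  have xs: "path xs" and longest: "\<And>ys. path ys \<Longrightarrow> length ys \<le> length xs"
    using arg_max_nat_lemma[of path "[u, w]" length "Suc (card V)", OF start] bound
    unfolding xs_def less_Suc_eq_le by blast+
  have len: "2 \<le> length xs" using longest[OF start] by simp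
  obtain a b rest where abr: "xs = a # b # rest"
    using len by (cases xs; cases "tl xs") auto
  have ab: "{a, b} \<in> F" using xs by (auto simp: path_def abr)
  have unique: "g = {a, b}" if g: "g \<in> F" "a \<in> g" for g
  proof (rule ccontr)
    assume "g \<noteq> {a, b}"
    have "g \<subseteq> V" "card g = 2" using g(1) assms(2) by (auto simp: simple_edges_on_def)
    then obtain c where "g = {a, c}" "c \<noteq> a" "c \<in> V"
      using g(2) by (auto simp: card_2_iff)
    moreover from this have "c \<noteq> b" using \<open>g \<noteq> {a, b}\<close> by blast
    ultimately have c: "g = {a, c}" "c \<noteq> a" "c \<noteq> b" "c \<in> V" by blast+
    have "c \<in> set xs"
    proof (rule ccontr)
      assume "c \<notin> set xs"
      moreover have "{(c # xs) ! i, (c # xs) ! Suc i} \<in> F" if "Suc i < length (c # xs)" for i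

      proof (cases i)
        case 0
        then show ?thesis using g(1) c(1) by (simp add: abr insert_commute[of c a])
      next
        case (Suc m)
        then show ?thesis using that xs by (simp add: path_def)
      qed
      ultimately have "path (c # xs)" using xs c(4) by (auto simp: path_def)
      then show False using longest by fastforce
    qed
    then obtain j where j: "j < length xs" "xs ! j = c" by (auto simp: in_set_conv_nth)
    have "j \<noteq> 0" "j \<noteq> 1"
      using j(2) c(2,3) by (metis abr nth_Cons_0, metis abr nth_Cons_0 nth_Cons_Suc One_nat_def)
    then have j2: "2 \<le> j" by simp
    let ?c = "take (Suc j) xs"
    have lc: "length ?c = Suc j" using j by simp
    have "{?c ! i, ?c ! (Suc i mod length ?c)} \<in> F" if "i < length ?c" for i
    proof (cases "i = j")
      case True

      have "?c ! (Suc i mod length ?c) = a" unfolding lc True by (simp add: abr)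
      moreover have "?c ! i = c" using True j by simp
      ultimately show ?thesis using g(1) c(1) by (simp add: insert_commute[of c a])
    next
      case False
      then have "Suc i < Suc j" using that lc by simp
      then show ?thesis using xs j lc by (simp add: path_def)
    qed
    then have "graph_cycle F ?c"
      using lc j2 xs by (simp add: graph_cycle_def path_def)
    then show False using acyclic by blast
  qed
  have "a \<in> V" using xs by (simp add: path_def abr)
  then show thesis by (rule that[OF _ ab _ unique]) simp_all
qed

lemma graph_cycle_mono: "graph_cycle F c \<Longrightarrow> F \<subseteq> G \<Longrightarrow> graph_cycle G c"
  by (auto simp: graph_cycle_def)

lemma acyclic_card_le:
  assumes "finite V" "V \<noteq> {}" "simple_edges_on V F" "\<nexists>c. graph_cycle F c"
  shows "1 + card F \<le> card V"
  using assms
proof (induction "card V" arbitrary: V F)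
  case 0
  then show ?case by simp
next
  case (Suc n)
  show ?case
  proof (cases "F = {}")
    case True
    then show ?thesis using Suc.prems by (simp add: Suc_le_eq card_gt_0_iff)
  next
    case False
    obtain v f where v: "v \<in> V" "f \<in> F" "v \<in> f" "\<And>g. g \<in> F \<Longrightarrow> v \<in> g \<Longrightarrow> g = f"
      using acyclic_leaf[OF Suc.prems(1,3) False Suc.prems(4)] by metis
    have simple: "simple_edges_on (V - {v}) (F - {f})"
      unfolding simple_edges_on_def
    proof
      fix g assume "g \<in> F - {f}"
      then have "g \<subseteq> V" "card g = 2" "v \<notin> g"
        using Suc.prems(3) v(4)[of g] by (auto simp: simple_edges_on_def)
      then show "g \<subseteq> V - {v} \<and> card g = 2" by blast
    qed
    have "f \<subseteq> V" "card f = 2" using Suc.prems(3) v(2) by (simp_all add: simple_edges_on_def)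
    then have "V - {v} \<noteq> {}" using card_mono[of "{v}" f] by auto
    moreover have "\<nexists>c. graph_cycle (F - {f}) c"
      using Suc.prems(4) graph_cycle_mono[of "F - {f}" _ F] by blast
    moreover have "n = card (V - {v})" using Suc.hyps(2) Suc.prems(1) v(1) by simp
    ultimately have "1 + card (F - {f}) \<le> card (V - {v})"
      using Suc.hyps(1)[of "V - {v}" "F - {f}"] Suc.prems(1) simple by simp
    moreover have "finite F" using finite_simple_edges[OF Suc.prems(1,3)] .
    then have "card F = Suc (card (F - {f}))" using v(2) by (rule card.remove)
    moreover have "card V = Suc (card (V - {v}))" using Suc.prems(1) v(1) by (rule card.remove)
    ultimately show ?thesis by simp
  qed
qed

text \<open>An edge of a cycle can be removed without disconnecting the graph, because the rest of the
  cycle crosses every cut that separates the ends of the edge. So a connected graph with a cycle has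
  an edge more than connectedness requires.\<close>

lemma connected_with_cycle_card_le:
  assumes "finite V" "simple_edges_on V F" "graph_connected V F" "graph_cycle F c"
  shows "card V \<le> card F"
proof -
  obtain m where m: "length c = Suc m" "2 \<le> m"
    using assms(4) by (cases "length c") (auto simp: graph_cycle_def)
  have step: "{c ! i, c ! Suc i} \<in> F" if "i < m" for i
    using assms(4) that m by (auto simp: graph_cycle_def dest!: spec[of _ i])
  have eq_iff: "c ! i = c ! j \<longleftrightarrow> i = j" if "i \<le> m" "j \<le> m" for i j
    using assms(4) that m by (simp add: graph_cycle_def nth_eq_iff_index_eq)
  define f where "f = {c ! m, c ! 0}"
  have f: "f \<in> F" using assms(4) m by (auto simp: graph_cycle_def f_def dest!: spec[of _ m])
  have "card V \<le> 1 + card (F - {f})"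
  proof (rule connected_card_le)
    show "simple_edges_on V (F - {f})" using assms(2) by (simp add: simple_edges_on_def)
    fix S assume S: "S \<noteq> {}" "S \<subset> V"
    show "\<exists>x y. {x, y} \<in> F - {f} \<and> x \<in> S \<and> y \<notin> S"
    proof (rule ccontr)
      assume no: "\<not> ?thesis"
      \<comment> \<open>the length of at least 3 keeps the closing edge \<open>f\<close> distinct from the other edges\<close>
      have step': "{c ! i, c ! Suc i} \<in> F - {f}" if "i < m" for i
        using step[OF that] that m(2) eq_iff[of i 0] eq_iff[of i m] eq_iff[of "Suc i" 0] eq_iff[of "Suc i" m]
        by (auto simp: f_def doubleton_eq_iff)
      have "c ! i \<in> S \<longleftrightarrow> c ! 0 \<in> S" if "i \<le> m" for i
        using that
      proof (induction i)
        case (Suc i)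
        have e: "{c ! i, c ! Suc i} \<in> F - {f}" using step'[of i] Suc.prems by simp
        then have "{c ! Suc i, c ! i} \<in> F - {f}" by (simp only: insert_commute[of "c ! Suc i"])
        with e have "c ! Suc i \<in> S \<longleftrightarrow> c ! i \<in> S" using no by blast
        then show ?case using Suc by simp
      qed simp
      then have same: "c ! m \<in> S \<longleftrightarrow> c ! 0 \<in> S" by blast
      obtain u v where "u \<in> V" "u \<in> S" "v \<in> V" "v \<notin> S" using S by blast
      then obtain x y where "{x, y} \<in> F" "x \<in> S" "y \<notin> S"
        using graph_connected_crossing_edge[OF assms(3)] by metis
      moreover from this no have "{x, y} = f" by blast
      ultimately show False using same by (auto simp: f_def doubleton_eq_iff)
    qed
  qed (use assms in simp)
  moreover have "finite F" using finite_simple_edges[OF assms(1,2)] .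
  then have "card F = Suc (card (F - {f}))" using f by (rule card.remove)
  ultimately show ?thesis by simp
qed

lemma simple_tree_iff_card:
  assumes "finite V"
  shows "simple_tree V F \<longleftrightarrow> simple_edges_on V F \<and> graph_connected V F \<and> card V = 1 + card F"
proof -
  have "(\<nexists>c. graph_cycle F c) \<longleftrightarrow> card V = 1 + card F"
    if F: "simple_edges_on V F" "graph_connected V F"
  proof
    have "card V \<le> 1 + card F"
    proof (rule connected_card_le[OF assms F(1)])
      fix S assume "S \<noteq> {}" "S \<subset> V"
      then obtain u v where "u \<in> V" "u \<in> S" "v \<in> V" "v \<notin> S" by blast
      then show "\<exists>x y. {x, y} \<in> F \<and> x \<in> S \<and> y \<notin> S"
        using graph_connected_crossing_edge[OF F(2)] by simp
    qed
    moreover assume "\<nexists>c. graph_cycle F c"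
    then have "1 + card F \<le> card V"
      using acyclic_card_le[OF assms _ F(1)] F(2) by (simp add: graph_connected_def)
    ultimately show "card V = 1 + card F" by simp
  next
    assume "card V = 1 + card F"
    then show "\<nexists>c. graph_cycle F c"
      using connected_with_cycle_card_le[OF assms F] by auto
  qed
  then show ?thesis unfolding simple_tree_def by blast
qed

section \<open>Gluing trees at a vertex\<close>

lemma edges_disjoint:
  assumes "simple_edges_on V1 F1" "simple_edges_on V2 F2" "V1 \<inter> V2 = {r}"
  shows "F1 \<inter> F2 = {}"
proof (rule ccontr)
  assume "F1 \<inter> F2 \<noteq> {}"
  then obtain f where "f \<in> F1" "f \<in> F2" by blast
  then have "f \<subseteq> V1 \<inter> V2" "card f = 2"
    using assms(1,2) by (simp_all add: simple_edges_on_def)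
  then show False using assms(3) card_mono[of "{r}" f] by simp
qed

text \<open>The shared vertex is counted twice in \<open>card V1 + card V2\<close>, which compensates exactly for one of
  the two units by which the trees have fewer edges than vertices.\<close>

lemma simple_tree_Un:
  assumes "finite V1" "finite V2" "V1 \<inter> V2 = {r}" "simple_tree V1 F1" "simple_tree V2 F2"
  shows "simple_tree (V1 \<union> V2) (F1 \<union> F2)"
proof -
  have t: "simple_edges_on V1 F1" "graph_connected V1 F1" "card V1 = 1 + card F1"
    "simple_edges_on V2 F2" "graph_connected V2 F2" "card V2 = 1 + card F2"
    using assms by (simp_all add: simple_tree_iff_card)
  let ?R = "\<lambda>F. {(x, y). {x, y} \<in> F}"
  have r: "r \<in> V1" "r \<in> V2" using assms(3) by auto
  have m: "(?R F1)\<^sup>* \<subseteq> (?R (F1 \<union> F2))\<^sup>*" "(?R F2)\<^sup>* \<subseteq> (?R (F1 \<union> F2))\<^sup>*"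
    by (intro rtrancl_mono; auto)+
  have to_r: "(u, r) \<in> (?R (F1 \<union> F2))\<^sup>*" "(r, u) \<in> (?R (F1 \<union> F2))\<^sup>*" if "u \<in> V1 \<union> V2" for u
    using that t(2,5) r m unfolding graph_connected_def by blast+
  have "graph_connected (V1 \<union> V2) (F1 \<union> F2)"
    unfolding graph_connected_def
  proof (intro conjI ballI)
    show "V1 \<union> V2 \<noteq> {}" using r by blast
    show "(u, v) \<in> (?R (F1 \<union> F2))\<^sup>*" if "u \<in> V1 \<union> V2" "v \<in> V1 \<union> V2" for u v
      using to_r(1)[OF that(1)] to_r(2)[OF that(2)] by (rule rtrancl_trans)
  qed
  moreover have "simple_edges_on (V1 \<union> V2) (F1 \<union> F2)"
    using t(1,4) by (auto simp: simple_edges_on_def)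
  moreover have "card (V1 \<union> V2) = 1 + card (F1 \<union> F2)"
  proof -
    have "finite F1" "finite F2"
      using finite_simple_edges assms(1,2) t(1,4) by blast+
    then have "card (F1 \<union> F2) = card F1 + card F2"
      using edges_disjoint[OF t(1,4) assms(3)] by (simp add: card_Un_disjoint)
    then show ?thesis using card_Un_Int[OF assms(1,2)] assms(3) t(3,6) by simp
  qed
  ultimately show ?thesis using assms(1,2) by (simp add: simple_tree_iff_card)
qed

lemma spanning_tree_Un:
  assumes "finite V1" "finite V2" "V1 \<inter> V2 = {r}" "spanning_tree V1 T1" "spanning_tree V2 T2"
  shows "spanning_tree (V1 \<union> V2) (T1 \<union> T2)"
proof -
  have "snd ` T1 \<inter> snd ` T2 = {}"
    using assms(3-5) edges_disjoint[of V1 _ V2] by (simp add: spanning_tree_def simple_tree_def)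
  then have "inj_on snd (T1 \<union> T2)"
    using assms(4,5) unfolding spanning_tree_def inj_on_Un by blast
  then show ?thesis
    using assms(4,5) simple_tree_Un[OF assms(1-3)] by (simp add: spanning_tree_def image_Un)
qed

lemma layer_contained_certificate_one_vertex_sum:
  assumes "multihypergraph H1" "multihypergraph H2"
    and c1: "layer_contained_certificate k H1 F1 T1 l1"
    and c2: "layer_contained_certificate k H2 F2 T2 l2"
    and V: "hverts H1 \<inter> hverts H2 = {r}" and E: "hedges H1 \<inter> hedges H2 = {}"
  shows "layer_contained_certificate k (one_vertex_sum H1 H2)
           (\<lambda>e. if e \<in> hedges H1 then F1 e else F2 e)
           (\<lambda>i. T1 i \<union> T2 i)
           (\<lambda>e. if e \<in> hedges H1 then l1 e else l2 e)"
    (is "layer_contained_certificate k ?H ?F ?T ?l")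
proof -
  have fin: "finite (hverts H1)" "finite (hverts H2)"
    using assms(1,2) by (auto simp: multihypergraph_def)
  note c = c1[unfolded layer_contained_certificate_def ordered_tree_decomposition_def]
    c2[unfolded layer_contained_certificate_def ordered_tree_decomposition_def]
  have E': "e \<notin> hedges H1" if "e \<in> hedges H2" for e using E that by blast
  have ae: "assigned_edges ?H ?F = assigned_edges H1 F1 \<union> assigned_edges H2 F2"
    by (auto simp: assigned_edges_def labelled_edges_def one_vertex_sum_def E')
  have dis: "assigned_edges H1 F1 \<inter> assigned_edges H2 F2 = {}"
    by (auto simp: assigned_edges_def labelled_edges_def E')
  have sub: "T1 i \<subseteq> assigned_edges H1 F1" "T2 i \<subseteq> assigned_edges H2 F2" if "i < k" for i
    using c that by auto
  have "tree_assignment ?H ?F"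
    using c by (auto simp: tree_assignment_def one_vertex_sum_def E')
  moreover have "(\<Union>i<k. ?T i) = assigned_edges ?H ?F"
    using c by (auto simp: ae)
  moreover have "?T i \<inter> ?T j = {}" if "i < k" "j < k" "i \<noteq> j" for i j
  proof -
    have "T1 i \<inter> T1 j = {}" "T2 i \<inter> T2 j = {}"
      using c that by (auto simp: disjoint_family_on_def)
    then show ?thesis using sub[OF that(1)] sub[OF that(2)] dis by blast
  qed
  then have "disjoint_family_on ?T {..<k}" by (auto simp: disjoint_family_on_def)
  moreover have "\<forall>i<k. spanning_tree (hverts ?H) (?T i)"
    using c by (auto simp: one_vertex_sum_def intro: spanning_tree_Un[OF fin V])
  moreover have "\<forall>e\<in>hedges ?H. ?l e < k \<and> labelled_edges ?F e \<subseteq> ?T (?l e)"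
  proof
    fix e assume "e \<in> hedges ?H"
    then consider "e \<in> hedges H1" | "e \<in> hedges H2" "e \<notin> hedges H1"
      by (auto simp: one_vertex_sum_def)
    then show "?l e < k \<and> labelled_edges ?F e \<subseteq> ?T (?l e)"
    proof cases
      case 1
      then have "l1 e < k" "labelled_edges F1 e \<subseteq> T1 (l1 e)" using c by simp_all
      then show ?thesis using 1 by (auto simp: labelled_edges_def)
    next
      case 2
      then have "l2 e < k" "labelled_edges F2 e \<subseteq> T2 (l2 e)" using c by simp_all
      then show ?thesis using 2 by (auto simp: labelled_edges_def)
    qed
  qed
  ultimately show ?thesis
    by (simp add: layer_contained_certificate_def ordered_tree_decomposition_def)
qed

section \<open>Consequences of a certificate\<close>

lemma spanning_tree_card:
  assumes "finite V" "spanning_tree V T"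
  shows "card V = 1 + card T" "finite T"
proof -
  have "card V = 1 + card (snd ` T)" "finite (snd ` T)" "inj_on snd T"
    using assms finite_simple_edges by (auto simp: spanning_tree_def simple_tree_iff_card)
  then show "card V = 1 + card T" "finite T"
    by (simp_all add: card_image finite_image_iff)
qed

lemma labelled_edges_card:
  assumes "multihypergraph H" "tree_assignment H F" "e \<in> hedges H"
  shows "card (support H e) = 1 + card (labelled_edges F e)" "finite (labelled_edges F e)"
proof -
  have fin: "finite (support H e)"
    using assms(1,3) finite_subset[of "support H e" "hverts H"] by (simp add: multihypergraph_def)
  have t: "simple_tree (support H e) (F e)" using assms(2,3) by (simp add: tree_assignment_def)
  then show "card (support H e) = 1 + card (labelled_edges F e)"
    using fin by (simp add: simple_tree_iff_card labelled_edges_def card_cartesian_product)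
  show "finite (labelled_edges F e)"
    using t finite_simple_edges[OF fin] by (simp add: simple_tree_def labelled_edges_def)
qed

lemma ordered_tree_decomposition_critical:
  assumes "multihypergraph H" "tree_assignment H F"
    and "ordered_tree_decomposition k (hverts H) (assigned_edges H F) T"
  shows "critical k H"
proof -
  have fin: "finite (hverts H)" "finite (hedges H)" using assms(1) by (auto simp: multihypergraph_def)
  note T = assms(3)[unfolded ordered_tree_decomposition_def]
  have tree: "card (hverts H) = 1 + card (T i)" "finite (T i)" if "i < k" for i
    using spanning_tree_card[OF fin(1), of "T i"] T that by simp_all
  have "hyper_rho H = (\<Sum>e\<in>hedges H. int (card (labelled_edges F e)))"
    unfolding hyper_rho_def using labelled_edges_card(1)[OF assms(1,2)] by (intro sum.cong) auto
  also have "\<dots> = int (card (assigned_edges H F))"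
    unfolding assigned_edges_def using fin(2) labelled_edges_card(2)[OF assms(1,2)]
    by (subst card_UN_disjoint) (auto simp: labelled_edges_def)
  also have "assigned_edges H F = (\<Union>i<k. T i)" using T by simp
  also have "card \<dots> = (\<Sum>i<k. card (T i))"
    using T tree(2) by (intro card_UN_disjoint) (auto simp: disjoint_family_on_def)
  also have "int \<dots> = (\<Sum>i<k. int (card (hverts H)) - 1)"
    using T tree(1) by simp
  finally show ?thesis by (simp add: critical_def)
qed

lemma layer_unique:
  assumes c: "layer_contained_certificate k H F T l"
    and "i < k" "(e, f) \<in> T i"
  shows "e \<in> hedges H" "f \<in> F e" "l e = i"
proof -
  note c' = c[unfolded layer_contained_certificate_def ordered_tree_decomposition_def]
  have "(e, f) \<in> assigned_edges H F" using c' assms(2,3) by blast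
  then show e: "e \<in> hedges H" "f \<in> F e" by (auto simp: assigned_edges_def labelled_edges_def)
  then have "l e < k" "(e, f) \<in> T (l e)" using c' by (auto simp: labelled_edges_def)
  then show "l e = i" using c' assms(2,3) by (auto simp: disjoint_family_on_def)
qed

text \<open>The hyperedges of one layer, seen as sets of blocks, form a connected hypergraph on the set of
  blocks: an edge of the spanning tree of the layer that leaves a union of blocks lies in one of
  these hyperedges.\<close>

lemma layer_partition_weight:
  assumes "multihypergraph H" and c: "layer_contained_certificate k H F T l"
    and P: "partition_on (hverts H) P" and "i < k"
  shows "card P \<le> 1 + (\<Sum>e | e \<in> hedges H \<and> l e = i. blocks_met H P e - 1)"
  unfolding blocks_met_def
proof (rule connected_hypergraph_card_le)
  have fin: "finite (hverts H)" "finite (hedges H)" using assms(1) by (auto simp: multihypergraph_def)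
  show "finite P" using finite_elements[OF fin(1) P] .
  show "finite {e \<in> hedges H. l e = i}" using fin(2) by simp
  fix S assume S: "S \<noteq> {}" "S \<subset> P"
  note c' = c[unfolded layer_contained_certificate_def ordered_tree_decomposition_def]
  obtain B C where BC: "B \<in> S" "B \<in> P" "C \<in> P" "C \<notin> S" using S by blast
  have ne: "D \<noteq> {}" "D \<subseteq> hverts H" if "D \<in> P" for D
    using partition_onD1[OF P] partition_onD3[OF P] that by blast+
  obtain u v where uv: "u \<in> B" "v \<in> C" using ne(1)[OF BC(2)] ne(1)[OF BC(3)] by blast
  then have V: "u \<in> hverts H" "v \<in> hverts H" using ne(2) BC(2,3) by blast+
  have disj: "D = D'" if "D \<in> P" "D' \<in> P" "x \<in> D" "x \<in> D'" for D D' x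
    using partition_onD2[OF P] that by (auto simp: disjoint_def)
  have "v \<notin> \<Union>S"
  proof
    assume "v \<in> \<Union>S"
    then obtain D where "D \<in> S" "v \<in> D" by blast
    then have "D = C" using disj[of D C v] uv(2) BC(3) S by blast
    then show False using \<open>D \<in> S\<close> BC(4) by simp
  qed
  moreover have "u \<in> \<Union>S" using uv BC by blast
  moreover have "graph_connected (hverts H) (snd ` T i)"
    using c' \<open>i < k\<close> by (simp add: spanning_tree_def simple_tree_def)
  ultimately obtain x y where xy: "{x, y} \<in> snd ` T i" "x \<in> \<Union>S" "y \<notin> \<Union>S"
    using graph_connected_crossing_edge[of "hverts H" "snd ` T i" u v "\<Union>S"] V by metis
  then obtain e where "(e, {x, y}) \<in> T i" by auto
  note e = layer_unique[OF c \<open>i < k\<close> this]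
  then have "simple_edges_on (support H e) (F e)"
    using c' by (simp add: tree_assignment_def simple_tree_def)
  then have supp: "x \<in> support H e" "y \<in> support H e"
    using e(2) unfolding simple_edges_on_def by blast+
  moreover have "support H e \<subseteq> \<Union>P"
    using e(1) assms(1) partition_onD1[OF P] by (simp add: multihypergraph_def)
  ultimately have "y \<in> \<Union>P" by blast
  then obtain D where D: "D \<in> P" "y \<in> D" by blast
  obtain D' where D': "D' \<in> S" "x \<in> D'" using xy(2) by blast
  let ?M = "{B \<in> P. B \<inter> support H e \<noteq> {}}"
  have "D' \<in> ?M \<inter> S" "D \<in> ?M" "D \<notin> S" using D D' supp S xy(3) by blast+
  then show "\<exists>e\<in>{e \<in> hedges H. l e = i}. {B \<in> P. B \<inter> support H e \<noteq> {}} \<inter> S \<noteq> {} \<and>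
      \<not> {B \<in> P. B \<inter> support H e \<noteq> {}} \<subseteq> S"
    using e(1,3) by (intro bexI[of _ e]) blast+
qed auto

lemma layer_contained_certificate_weakly_partition_connected:
  assumes "multihypergraph H" and c: "layer_contained_certificate k H F T l"
  shows "weakly_partition_connected k H"
  unfolding weakly_partition_connected_def
proof (intro allI impI)
  fix P assume P: "partition_on (hverts H) P"
  have fin: "finite (hverts H)" "finite (hedges H)" using assms(1) by (auto simp: multihypergraph_def)
  have pos: "blocks_met H P e \<ge> 1" if e: "e \<in> hedges H" for e
  proof -
    have "support H e \<noteq> {}" "support H e \<subseteq> \<Union>P"
      using assms(1) e partition_onD1[OF P] by (auto simp: multihypergraph_def)
    then have "{B \<in> P. B \<inter> support H e \<noteq> {}} \<noteq> {}" by blast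
    then show ?thesis
      using finite_elements[OF fin(1) P] by (simp add: blocks_met_def Suc_le_eq card_gt_0_iff)
  qed
  let ?A = "\<lambda>i. {e \<in> hedges H. l e = i}"
  have "int (card P) - 1 \<le> (\<Sum>e\<in>?A i. int (blocks_met H P e) - 1)" if "i < k" for i
  proof -
    have "(\<Sum>e\<in>?A i. int (blocks_met H P e) - 1) = (\<Sum>e\<in>?A i. int (blocks_met H P e - 1))"
      by (rule sum.cong) (use pos in \<open>auto simp: of_nat_diff\<close>)
    then show ?thesis using layer_partition_weight[OF assms P that]
      by (simp flip: of_nat_sum)
  qed
  then have "(\<Sum>i<k. int (card P) - 1) \<le> (\<Sum>i<k. \<Sum>e\<in>?A i. int (blocks_met H P e) - 1)"
    by (intro sum_mono) simp
  also have "\<dots> = partition_weight H P"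
    unfolding partition_weight_def using fin(2) c
    by (intro sum.group) (auto simp: layer_contained_certificate_def)
  finally show "int k * (int (card P) - 1) \<le> partition_weight H P" by simp
qed

text \<open>Termwise \<open>j * n i \<le> i * n i\<close>, so equality of the sums forces equality of all terms. Applied to
  the numbers of edges of a hyperedge in the layers of a decomposition, this extracts a layer from
  the signature.\<close>

lemma minimal_weighted_sum:
  fixes n :: "nat \<Rightarrow> nat"
  assumes "\<And>i. i < j \<Longrightarrow> n i = 0" "(\<Sum>i<k. i * n i) = j * (\<Sum>i<k. n i)" "i < k" "i \<noteq> j"
  shows "n i = 0"
proof -
  have le: "j * n i \<le> i * n i" for i
    using assms(1)[of i] by (cases "i < j") auto
  have "(\<Sum>i<k. j * n i) = (\<Sum>i<k. i * n i)" using assms(2) by (simp add: sum_distrib_left)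
  then have "j * n i = i * n i"
    using sum_mono_inv[of "\<lambda>i. j * n i" "{..<k}" "\<lambda>i. i * n i" i] le assms(3) by auto
  then show ?thesis using assms(4) by simp
qed

lemma ordered_tree_decomposition_card_split:
  assumes "ordered_tree_decomposition k V (assigned_edges H F) T" "e \<in> hedges H"
    and "finite (labelled_edges F e)"
  shows "card (labelled_edges F e) = (\<Sum>i<k. card (T i \<inter> labelled_edges F e))"
proof -
  have "labelled_edges F e = (\<Union>i<k. T i \<inter> labelled_edges F e)"
    using assms(1,2) by (auto simp: ordered_tree_decomposition_def assigned_edges_def)
  then have "card (labelled_edges F e) = card (\<Union>i<k. T i \<inter> labelled_edges F e)" by simp
  also have "\<dots> = (\<Sum>i<k. card (T i \<inter> labelled_edges F e))"
    using assms(1,3)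
    by (intro card_UN_disjoint) (auto simp: ordered_tree_decomposition_def disjoint_family_on_def)
  finally show ?thesis .
qed

lemma layer_contained_certificate_signature:
  assumes "layer_contained_certificate k H F T l" "e \<in> hedges H"
  shows "tree_signature k F T e = l e * card (labelled_edges F e)"
proof -
  have le: "l e < k" "labelled_edges F e \<subseteq> T (l e)"
    using assms by (auto simp: layer_contained_certificate_def)
  have "T i \<inter> labelled_edges F e = (if i = l e then labelled_edges F e else {})" if "i < k" for i
    using layer_unique[OF assms(1) that] le(2) by (auto simp: labelled_edges_def)
  then have "tree_signature k F T e = (\<Sum>i<k. if i = l e then i * card (labelled_edges F e) else 0)"
    unfolding tree_signature_def by (intro sum.cong) auto
  then show ?thesis using le(1) by simp
qed

text \<open>The layers of a competing decomposition \<open>T'\<close> are recovered in increasing order. When those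
  below \<open>j\<close> agree, no edge of a hyperedge of label \<open>j\<close> is left over for them, so the signature, which
  is the least possible one, forces these edges into \<open>T' j\<close>. Thus \<open>T j \<subseteq> T' j\<close>, and spanning trees
  have equal size.\<close>

lemma layer_contained_certificate_distinguishable:
  assumes "multihypergraph H" and c: "layer_contained_certificate k H F T l"
  shows "distinguishable k H F"
proof -
  have fin: "finite (hverts H)" using assms(1) by (auto simp: multihypergraph_def)
  note c' = c[unfolded layer_contained_certificate_def]
  have T: "ordered_tree_decomposition k (hverts H) (assigned_edges H F) T"
    and asg: "tree_assignment H F" using c' by auto
  have "T' j = T j" if T': "ordered_tree_decomposition k (hverts H) (assigned_edges H F) T'"
    and sig: "\<forall>e\<in>hedges H. tree_signature k F T' e = tree_signature k F T e" and "j < k" for T' j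
    using \<open>j < k\<close>
  proof (induction j rule: less_induct)
    case (less j)
    have "T j \<subseteq> T' j"
    proof (rule subrelI)
      fix e f assume ef: "(e, f) \<in> T j"
      note e = layer_unique[OF c less.prems ef]
      let ?n = "\<lambda>i. card (T' i \<inter> labelled_edges F e)"
      note finL = labelled_edges_card(2)[OF assms(1) asg e(1)]
      have below: "?n i = 0" if "i < j" for i
      proof -
        have "i < k" "T' i = T i" using that less by auto
        then have "T' i \<inter> labelled_edges F e = {}"
          using layer_unique(3)[OF c] e(3) that by (auto simp: labelled_edges_def)
        then show ?thesis by simp
      qed
      have "(\<Sum>i<k. i * ?n i) = j * (\<Sum>i<k. ?n i)"
        using sig e layer_contained_certificate_signature[OF c e(1)]
          ordered_tree_decomposition_card_split[OF T' e(1) finL]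
        by (simp add: tree_signature_def)
      then have above: "?n i = 0" if "i < k" "i \<noteq> j" for i
        using minimal_weighted_sum[of j ?n k i] below that by blast
      have mem: "(e, f) \<in> labelled_edges F e" using e(2) by (simp add: labelled_edges_def)
      then obtain i where i: "i < k" "(e, f) \<in> T' i"
        using T' e(1) by (auto simp: ordered_tree_decomposition_def assigned_edges_def)
      then have "?n i \<noteq> 0" using finL mem by (auto simp: card_eq_0_iff)
      then have "i = j" using above[OF i(1)] by argo
      then show "(e, f) \<in> T' j" using i(2) by simp
    qed
    moreover have "finite (T' j)" "card (T j) = card (T' j)"
      using spanning_tree_card[OF fin, of "T j"] spanning_tree_card[OF fin, of "T' j"] T T' less.prems
      by (auto simp: ordered_tree_decomposition_def)
    ultimately show ?case using card_subset_eq by blast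
  qed
  then show ?thesis unfolding distinguishable_def using T by blast
qed

section \<open>One-vertex sums\<close>

theorem theorem1p8:
  fixes k :: nat and H1 H2 :: "('v, 'e) mhg" and r :: 'v
  assumes "1 \<le> k"
    and "multihypergraph H1" and "multihypergraph H2"
    and "\<exists>F T l. layer_contained_certificate k H1 F T l"
    and "\<exists>F T l. layer_contained_certificate k H2 F T l"
    and "hverts H1 \<inter> hverts H2 = {r}"
    and "hedges H1 \<inter> hedges H2 = {}"
  shows "(\<exists>F T l. layer_contained_certificate k (one_vertex_sum H1 H2) F T l) \<and>
         critical k (one_vertex_sum H1 H2) \<and>
         weakly_partition_connected k (one_vertex_sum H1 H2) \<and>
         (\<exists>F. tree_assignment (one_vertex_sum H1 H2) F \<and>
              distinguishable k (one_vertex_sum H1 H2) F)"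
proof -
  let ?H = "one_vertex_sum H1 H2"
  have H: "multihypergraph ?H" using assms(2,3) by (rule multihypergraph_one_vertex_sum)
  obtain F T l where c: "layer_contained_certificate k ?H F T l"
    using assms(4,5) layer_contained_certificate_one_vertex_sum[OF assms(2,3) _ _ assms(6,7)] by blast
  then have "tree_assignment ?H F"
    "ordered_tree_decomposition k (hverts ?H) (assigned_edges ?H F) T"
    by (auto simp: layer_contained_certificate_def)
  then show ?thesis
    using c ordered_tree_decomposition_critical[OF H]
      layer_contained_certificate_weakly_partition_connected[OF H c]
      layer_contained_certificate_distinguishable[OF H c]
    by blast
qed

end
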